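(* Let $n\ge 3$. The type-$DD$ structure $(M,\delta^1)=\widehat{CFDD}(\mathcal{H},0)$ of the complement of the $(2,2n)$-torus link in $S^3$ (given explicitly in the context) is homotopy equivalent, as a type-$DD$ structure, to the type-$DD$ structure $(N,(\delta^1)')$ with generators $\underline{\mathbf{ab}}$; $\underline{\mathbf{ay_{2k}}}$ and $\underline{\mathbf{x_{2k}b}}$ for $1\le k\le n-1$; $\underline{\mathbf{x_ky_k}}$ for $1\le k\le 2n-1$; and structure map \begin{align*} \underline{\mathbf{ab}} &\mapsto \rho_{123}\sigma_{123}\otimes\underline{\mathbf{x_1y_1}}+(\rho_1\sigma_3+\rho_3\sigma_1)\otimes\underline{\mathbf{x_ny_n}},\\ \underline{\mathbf{ay_{2k}}} &\mapsto \rho_1\otimes\underline{\mathbf{x_ky_k}}+\rho_3\otimes\underline{\mathbf{x_{n+k}y_{n+k}}}, && k=1,\dots,n-1,\\ \underline{\mathbf{x_{2k}b}} &\mapsto \sigma_1\otimes\underline{\mathbf{x_ky_k}}+\sigma_3\otimes\underline{\mathbf{x_{n+k}y_{n+k}}}+\rho_{23}\sigma_{123}\otimes\underline{\mathbf{x_{k+1}y_{k+1}}}, && k=1,\dots,n-1,\\ \underline{\mathbf{x_ky_k}} &\mapsto 0, && k=1,\dots,n-1,\\ \underline{\mathbf{x_ky_k}} &\mapsto \rho_2\sigma_{23}\otimes\underline{\mathbf{ay_{2(k-n+1)}}}+\rho_{23}\sigma_2\otimes\underline{\mathbf{x_{2(k-n+1)}b}}, && k=n,\dots,2n-2,\\ \underline{\mathbf{x_{2n-1}y_{2n-1}}}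 &\mapsto \rho_2\sigma_2\otimes\underline{\mathbf{ab}}. \end{align*}
   Context: Everything is over $\mathbb{F}_2$. **Algebras.** The torus algebra has basis $\iota_1,\iota_2,\rho_1,\rho_2,\rho_3,\rho_{12},\rho_{23},\rho_{123}$, zero differential, orthogonal idempotents $\iota_1,\iota_2$ with $\iota_1+\iota_2=1$, $\rho_1=\iota_1\rho_1\iota_2$, $\rho_2=\iota_2\rho_2\iota_1$, $\rho_3=\iota_1\rho_3\iota_2$, and the only nonzero products of $\rho$'s are $\rho_1\rho_2=\rho_{12}$, $\rho_2\rho_3=\rho_{23}$, $\rho_1\rho_{23}=\rho_{12}\rho_3=\rho_{123}$. $\mathcal{A}_L=\mathcal{A}(-\mathcal{Z}_L)$ is this algebra; $\mathcal{A}_R=\mathcal{A}(-\mathcal{Z}_R)$ is a second copy with generators written $\sigma_I$. We write $\rho_I\sigma_J$ for $\rho_I\otimes\sigma_J\in\mathcal{A}_L\otimes\mathcal{A}_R$; a missing factor means $1$. **Type-$DD$ structures.** A type-$DD$ structure over $\mathcal{A}_L,\mathcal{A}_R$ is a vector space $M$ with commuting left actions of the idempotent subalgebras of $\mathcal{A}_L$ and $\mathcal{A}_R$, and an idempotent-compatible linear map $\delta^1:M\to(\mathcal{A}_L\otimes\mathcal{A}_R)\otimes M$ (tensor over the idempotents) with $(\mu\otimes\mathbb{I}_M)\circ(\mathbb{I}\otimes\delta^1)\circ\delta^1=0$, where $\mu$ is multiplication in $\mathcal{A}_L\otimes\mathcal{A}_R$ (the algebras have zero differential). For idempotent-compatible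 linear maps $f:M\to\mathcal{A}_L\otimes\mathcal{A}_R\otimes N$ and $g:N\to\mathcal{A}_L\otimes\mathcal{A}_R\otimes P$ put $g\circ f:=(\mu\otimes\mathbb{I}_P)(\mathbb{I}\otimes g)f$. A homomorphism $f$ from $(M,\delta_M)$ to $(N,\delta_N)$ is such a map with $\delta_N\circ f+f\circ\delta_M=0$. Homomorphisms $f,f'$ are homotopic if $f+f'=\delta_N\circ h+h\circ\delta_M$ for some such map $h$. $M$ and $N$ are homotopy equivalent if there are homomorphisms $F:M\to N$, $G:N\to M$ with $G\circ F$ and $F\circ G$ homotopic to the identities. **Idempotents** (left algebra, right algebra), for $M$ and for the underlined generators of $N$ alike: $\mathbf{ab}$: $(\iota_1,\iota_1)$; $\mathbf{ay_{2k}}$: $(\iota_1,\iota_2)$; $\mathbf{x_{2k}b}$: $(\iota_2,\iota_1)$; $\mathbf{x_iy_j}$: $(\iota_2,\iota_2)$. **The type-$DD$ structure $(M,\delta^1)$ of the $(2,2n)$-torus link complement.** This is the summand $\widehat{CFDD}(\mathcal{H},0)$ of the bordered Floer bimodule $\widehat{CFDD}$ of the complement (for the arced bordered Heegaard diagram $\mathcal{H}$ coming from the Schubert normal form), on which both torus algebras act through their middle (genus-one, nontrivial) summands. Its generators are $\mathbf{x_iy_j}$ ($1\le i,j\le 2n-1$, $i\equiv j$ mod 2), $\mathbf{ab}$, and $\mathbf{ay_k},\mathbf{x_kb}$ ($k=2,4,\dots,2n-2$). With $\mathbf{xy}(i,j):=\mathbf{x_iy_j}+\mathbf{x_jy_i}$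 for $i\ne j$ and $\mathbf{xy}(i,i):=\mathbf{x_iy_i}$, the map $\delta^1$ is: - for $i,j\ne 2n-1$: $\mathbf{x_iy_j}\mapsto \mathbf{xy}(i+1,j-1)+\rho_{23}\sigma_{23}\mathbf{x_{i+1}y_{j+1}}$ if $i<j$; $\mathbf{x_iy_j}\mapsto\mathbf{xy}(i-1,j+1)+\rho_{23}\sigma_{23}\mathbf{x_{i+1}y_{j+1}}$ if $i>j$; $\mathbf{x_iy_i}\mapsto\rho_{23}\sigma_{23}\mathbf{x_{i+1}y_{i+1}}$; - $\mathbf{x_iy_{2n-1}}\mapsto\mathbf{xy}(i+1,2n-2)+\rho_{23}\sigma_2\mathbf{x_{i+1}b}$ for $i=1,3,\dots,2n-3$; - $\mathbf{x_{2n-1}y_j}\mapsto\mathbf{xy}(2n-2,j+1)+\rho_2\sigma_{23}\mathbf{ay_{j+1}}$ for $j=1,3,\dots,2n-3$; - $\mathbf{x_{2n-1}y_{2n-1}}\mapsto\rho_2\sigma_2\mathbf{ab}$; - $\mathbf{ay_j}\mapsto\rho_1\mathbf{xy}(1,j-1)+\rho_3\mathbf{xy}(j+1,2n-1)+\rho_{123}\sigma_{23}\mathbf{x_{j+1}y_1}$ for $j=2,4,\dots,2n-2$; - $\mathbf{x_ib}\mapsto\sigma_1\mathbf{xy}(1,i-1)+\sigma_3\mathbf{xy}(i+1,2n-1)+\rho_{23}\sigma_{123}\mathbf{x_1y_{i+1}}$ for $i=2,4,\dots,2n-2$; - $\mathbf{ab}\mapsto(\rho_1\sigma_3+\rho_3\sigma_1)\mathbf{xy}(1,2n-1)+\rho_{123}\sigma_{123}\mathbf{x_1y_1}$.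 *)

theory Defs
  imports Complex_Main "HOL-Library.Z2" "HOL-Library.Function_Algebras"
begin

text \<open>The ground field is the library type \<^typ>\<open>bit\<close>, the field with two elements.
  Spaces of functions carry the pointwise group structure of Function\_Algebras.\<close>

section \<open>The torus algebra\<close>

datatype idem = Iota1 | Iota2

text \<open>The standard basis of the torus algebra. The second copy, with generators
  written \<open>\<sigma>\<^sub>I\<close>, is the same algebra, so the same names are used in the right-hand factor.\<close>

datatype torus = Idem idem | Rho1 | Rho2 | Rho3 | Rho12 | Rho23 | Rho123

abbreviation iota2 :: torus where "iota2 \<equiv> Idem Iota2"

instance torus :: finite
proof
  have "(UNIV :: torus set) \<subseteq>
      {Idem Iota1, Idem Iota2, Rho1, Rho2, Rho3, Rho12, Rho23, Rho123}"
  proof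
    fix a :: torus
    show "a \<in> {Idem Iota1, Idem Iota2, Rho1, Rho2, Rho3, Rho12, Rho23, Rho123}"
    proof (cases a)
      case (Idem i)
      then show ?thesis by (cases i) auto
    qed auto
  qed
  then show "finite (UNIV :: torus set)"
    by (rule finite_subset) simp
qed

text \<open>A basis element \<open>a\<close> satisfies \<open>a = \<iota> a \<iota>'\<close> for the idempotents
  \<open>\<iota> = left_idem a\<close> and \<open>\<iota>' = right_idem a\<close>.\<close>

fun left_idem :: "torus \<Rightarrow> idem" where
  "left_idem (Idem i) = i"
| "left_idem Rho1 = Iota1"
| "left_idem Rho2 = Iota2"
| "left_idem Rho3 = Iota1"
| "left_idem Rho12 = Iota1"
| "left_idem Rho23 = Iota2"
| "left_idem Rho123 = Iota1"

fun right_idem :: "torus \<Rightarrow> idem" where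
  "right_idem (Idem i) = i"
| "right_idem Rho1 = Iota2"
| "right_idem Rho2 = Iota1"
| "right_idem Rho3 = Iota2"
| "right_idem Rho12 = Iota1"
| "right_idem Rho23 = Iota2"
| "right_idem Rho123 = Iota2"

text \<open>Products of basis elements are again basis elements or zero; \<open>None\<close> stands for zero.\<close>

fun torus_mult :: "torus \<Rightarrow> torus \<Rightarrow> torus option" where
  "torus_mult (Idem i) b = (if left_idem b = i then Some b else None)"
| "torus_mult a (Idem j) = (if right_idem a = j then Some a else None)"
| "torus_mult Rho1 Rho2 = Some Rho12"
| "torus_mult Rho2 Rho3 = Some Rho23"
| "torus_mult Rho1 Rho23 = Some Rho123"
| "torus_mult Rho12 Rho3 = Some Rho123"
| "torus_mult _ _ = None"

text \<open>Multiplication in \<open>A\<^sub>L \<otimes> A\<^sub>R\<close>, whose basis consists of the pairs \<open>(a, b) = a \<otimes> b\<close>.\<close>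

definition mult2 :: "torus \<times> torus \<Rightarrow> torus \<times> torus \<Rightarrow> (torus \<times> torus) option" where
  "mult2 p q =
    (case (torus_mult (fst p) (fst q), torus_mult (snd p) (snd q)) of
       (Some a, Some b) \<Rightarrow> Some (a, b)
     | _ \<Rightarrow> None)"


section \<open>Type-DD structures\<close>

text \<open>Let \<open>M\<close> be a vector space with commuting left actions of the two idempotent
  subalgebras. As a right module over the idempotents, \<open>A\<^sub>L \<otimes> A\<^sub>R\<close> is the direct sum of the
  lines spanned by the basis elements \<open>a \<otimes> b\<close>. Hence the tensor product of
  \<open>A\<^sub>L \<otimes> A\<^sub>R\<close> with \<open>M\<close> over the idempotents is the direct sum over \<open>(a, b)\<close> of copies of
  the subspace of \<open>M\<close> fixed by the right idempotents of \<open>a\<close> and \<open>b\<close>. Its elements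
  are written as functions \<open>\<phi>\<close>, standing for the sum of all \<open>a \<otimes> b \<otimes> \<phi> (a, b)\<close>.
  In the same way \<open>p, q \<mapsto> \<Psi> p q\<close> stands for the sum of all \<open>p \<otimes> q \<otimes> \<Psi> p q\<close>.\<close>

type_synonym 'm tensor = "torus \<times> torus \<Rightarrow> 'm"

text \<open>The underlying vector space is a subspace \<open>carr\<close> of an ambient space \<open>'m\<close>; what the
  maps do outside \<open>carr\<close> is irrelevant. The actions of the idempotent subalgebras are given
  by the actions of \<open>\<iota>\<^sub>1\<close> and \<open>\<iota>\<^sub>2\<close>.\<close>

record 'm dd =
  carr :: "'m set"
  scale :: "bit \<Rightarrow> 'm \<Rightarrow> 'm"
  actL :: "idem \<Rightarrow> 'm \<Rightarrow> 'm"
  actR :: "idem \<Rightarrow> 'm \<Rightarrow> 'm"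
  delta :: "'m \<Rightarrow> 'm tensor"

definition idem_action ::
    "'m::ab_group_add set \<Rightarrow> (bit \<Rightarrow> 'm \<Rightarrow> 'm) \<Rightarrow> (idem \<Rightarrow> 'm \<Rightarrow> 'm) \<Rightarrow> bool" where
  "idem_action C s e \<longleftrightarrow>
     (\<forall>i. \<forall>x\<in>C. e i x \<in> C) \<and>
     (\<forall>i. \<forall>x\<in>C. \<forall>y\<in>C. e i (x + y) = e i x + e i y) \<and>
     (\<forall>i c. \<forall>x\<in>C. e i (s c x) = s c (e i x)) \<and>
     (\<forall>i j. \<forall>x\<in>C. e i (e j x) = (if i = j then e i x else 0)) \<and>
     (\<forall>x\<in>C. e Iota1 x + e Iota2 x = x)"

definition bimodule :: "'m::ab_group_add dd \<Rightarrow> bool" where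
  "bimodule M \<longleftrightarrow>
     vector_space (scale M) \<and> module.subspace (scale M) (carr M) \<and>
     idem_action (carr M) (scale M) (actL M) \<and>
     idem_action (carr M) (scale M) (actR M) \<and>
     (\<forall>i j. \<forall>x\<in>carr M. actL M i (actR M j x) = actR M j (actL M i x))"

definition tensor_carr :: "'m dd \<Rightarrow> 'm tensor set" where
  "tensor_carr M =
     {\<phi>. \<forall>a b. \<phi> (a, b) \<in> carr M \<and>
        actL M (right_idem a) (actR M (right_idem b) (\<phi> (a, b))) = \<phi> (a, b)}"

definition tensor_actL :: "idem \<Rightarrow> 'm::zero tensor \<Rightarrow> 'm tensor" where
  "tensor_actL i \<phi> = (\<lambda>(a, b). if left_idem a = i then \<phi> (a, b) else 0)"

definition tensor_actR :: "idem \<Rightarrow> 'm::zero tensor \<Rightarrow> 'm tensor" where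
  "tensor_actR j \<phi> = (\<lambda>(a, b). if left_idem b = j then \<phi> (a, b) else 0)"

text \<open>Idempotent-compatible linear maps \<open>M \<rightarrow> A\<^sub>L \<otimes> A\<^sub>R \<otimes> N\<close>.\<close>

definition dd_map ::
    "'m::ab_group_add dd \<Rightarrow> 'k::ab_group_add dd \<Rightarrow> ('m \<Rightarrow> 'k tensor) \<Rightarrow> bool" where
  "dd_map M N f \<longleftrightarrow>
     (\<forall>x\<in>carr M. f x \<in> tensor_carr N) \<and>
     (\<forall>x\<in>carr M. \<forall>y\<in>carr M. f (x + y) = f x + f y) \<and>
     (\<forall>c. \<forall>x\<in>carr M. f (scale M c x) = (\<lambda>p. scale N c (f x p))) \<and>
     (\<forall>i. \<forall>x\<in>carr M. f (actL M i x) = tensor_actL i (f x)) \<and>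
     (\<forall>j. \<forall>x\<in>carr M. f (actR M j x) = tensor_actR j (f x))"

text \<open>\<open>mu\<close> is \<open>\<mu> \<otimes> \<I>\<close>, and the second factor of \<open>dd_comp\<close> is \<open>(\<I> \<otimes> g) \<circ> f\<close>.\<close>

definition mu :: "(torus \<times> torus \<Rightarrow> torus \<times> torus \<Rightarrow> 'm::ab_group_add) \<Rightarrow> 'm tensor" where
  "mu \<Psi> = (\<lambda>r. \<Sum>(p, q) \<in> {(p, q). mult2 p q = Some r}. \<Psi> p q)"

definition dd_comp ::
    "('k \<Rightarrow> 'l::ab_group_add tensor) \<Rightarrow> ('m \<Rightarrow> 'k tensor) \<Rightarrow> 'm \<Rightarrow> 'l tensor"
    (infixr "\<odot>" 70) where
  "g \<odot> f = (\<lambda>x. mu (\<lambda>p q. g (f x p) q))"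

text \<open>The map \<open>x \<mapsto> 1 \<otimes> x\<close>, where \<open>1\<close> is the sum of the four elements \<open>\<iota>\<^sub>i \<otimes> \<iota>\<^sub>j\<close>.\<close>

definition dd_id :: "'m::zero dd \<Rightarrow> 'm \<Rightarrow> 'm tensor" where
  "dd_id M x = (\<lambda>p. case p of (Idem i, Idem j) \<Rightarrow> actL M i (actR M j x) | _ \<Rightarrow> 0)"

definition type_DD :: "'m::ab_group_add dd \<Rightarrow> bool" where
  "type_DD M \<longleftrightarrow>
     bimodule M \<and> dd_map M M (delta M) \<and> (\<forall>x\<in>carr M. (delta M \<odot> delta M) x = 0)"

definition dd_hom ::
    "'m::ab_group_add dd \<Rightarrow> 'k::ab_group_add dd \<Rightarrow> ('m \<Rightarrow> 'k tensor) \<Rightarrow> bool" where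
  "dd_hom M N f \<longleftrightarrow>
     dd_map M N f \<and> (\<forall>x\<in>carr M. (delta N \<odot> f) x + (f \<odot> delta M) x = 0)"

definition dd_homotopic ::
    "'m::ab_group_add dd \<Rightarrow> 'k::ab_group_add dd \<Rightarrow>
      ('m \<Rightarrow> 'k tensor) \<Rightarrow> ('m \<Rightarrow> 'k tensor) \<Rightarrow> bool" where
  "dd_homotopic M N f f' \<longleftrightarrow>
     (\<exists>h. dd_map M N h \<and>
        (\<forall>x\<in>carr M. f x + f' x = (delta N \<odot> h) x + (h \<odot> delta M) x))"

definition dd_homotopy_equivalent ::
    "'m::ab_group_add dd \<Rightarrow> 'k::ab_group_add dd \<Rightarrow> bool" where
  "dd_homotopy_equivalent M N \<longleftrightarrow>
     (\<exists>F G. dd_hom M N F \<and> dd_hom N M G \<and>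
        dd_homotopic M M (G \<odot> F) (dd_id M) \<and>
        dd_homotopic N N (F \<odot> G) (dd_id N))"


section \<open>Structures given by generators\<close>

text \<open>\<open>AY k\<close>, \<open>XB k\<close> and \<open>XY i j\<close> are \<open>ay\<^sub>k\<close>, \<open>x\<^sub>kb\<close> and \<open>x\<^sub>iy\<^sub>j\<close>; the same names are used
  for the underlined generators.\<close>

datatype gen = AB | AY nat | XB nat | XY nat nat

fun gen_idem :: "gen \<Rightarrow> idem \<times> idem" where
  "gen_idem AB = (Iota1, Iota1)"
| "gen_idem (AY k) = (Iota1, Iota2)"
| "gen_idem (XB k) = (Iota2, Iota1)"
| "gen_idem (XY i j) = (Iota2, Iota2)"

text \<open>The structure whose vector space has as basis the finite set \<open>S\<close> of generators,
  elements being coordinate functions supported on \<open>S\<close>, and whose structure map is the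
  linear extension of \<open>d\<close>.\<close>

definition dd_of :: "gen set \<Rightarrow> (gen \<Rightarrow> (gen \<Rightarrow> bit) tensor) \<Rightarrow> (gen \<Rightarrow> bit) dd" where
  "dd_of S d =
    \<lparr> carr = {v. \<forall>g. g \<notin> S \<longrightarrow> v g = 0},
      scale = (\<lambda>c v g. c * v g),
      actL = (\<lambda>i v g. if fst (gen_idem g) = i then v g else 0),
      actR = (\<lambda>j v g. if snd (gen_idem g) = j then v g else 0),
      delta = (\<lambda>v p h. \<Sum>g\<in>S. v g * d g p h) \<rparr>"

definition bas :: "gen \<Rightarrow> gen \<Rightarrow> bit" where
  "bas g = (\<lambda>h. if h = g then 1 else 0)"

text \<open>\<open>(a, b) \<otimes> v\<close> is the pure tensor \<open>a \<otimes> b \<otimes> v\<close>. It is used only for \<open>v\<close> fixed by the right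
  idempotents of \<open>a\<close> and \<open>b\<close>. A missing algebra factor \<open>1\<close> therefore becomes the idempotent
  of \<open>v\<close> on that side, e.g. \<open>\<rho>\<^sub>1 x\<^sub>iy\<^sub>j = \<rho>\<^sub>1 \<otimes> \<iota>\<^sub>2 \<otimes> x\<^sub>iy\<^sub>j\<close>.\<close>

definition pure_tensor :: "torus \<times> torus \<Rightarrow> 'm::zero \<Rightarrow> 'm tensor" (infixr "\<otimes>" 75) where
  "p \<otimes> v = (\<lambda>q. if q = p then v else 0)"


section \<open>The two type-DD structures\<close>

definition xy :: "nat \<Rightarrow> nat \<Rightarrow> gen \<Rightarrow> bit" where
  "xy i j = (if i = j then bas (XY i i) else bas (XY i j) + bas (XY j i))"

definition link_gens :: "nat \<Rightarrow> gen set" where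
  "link_gens n =
     {AB} \<union>
     {AY k | k. even k \<and> 2 \<le> k \<and> k \<le> 2*n - 2} \<union>
     {XB k | k. even k \<and> 2 \<le> k \<and> k \<le> 2*n - 2} \<union>
     {XY i j | i j. 1 \<le> i \<and> i \<le> 2*n - 1 \<and> 1 \<le> j \<and> j \<le> 2*n - 1 \<and> even (i + j)}"

fun link_delta :: "nat \<Rightarrow> gen \<Rightarrow> (gen \<Rightarrow> bit) tensor" where
  "link_delta n (XY i j) =
     (if i = 2*n - 1 \<and> j = 2*n - 1 then (Rho2, Rho2) \<otimes> bas AB
      else if j = 2*n - 1 then
        (iota2, iota2) \<otimes> xy (i + 1) (2*n - 2) + (Rho23, Rho2) \<otimes> bas (XB (i + 1))
      else if i = 2*n - 1 then
        (iota2, iota2) \<otimes> xy (2*n - 2) (j + 1) + (Rho2, Rho23) \<otimes> bas (AY (j + 1))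
      else if i < j then
        (iota2, iota2) \<otimes> xy (i + 1) (j - 1) + (Rho23, Rho23) \<otimes> bas (XY (i + 1) (j + 1))
      else if i > j then
        (iota2, iota2) \<otimes> xy (i - 1) (j + 1) + (Rho23, Rho23) \<otimes> bas (XY (i + 1) (j + 1))
      else (Rho23, Rho23) \<otimes> bas (XY (i + 1) (i + 1)))"
| "link_delta n (AY j) =
     (Rho1, iota2) \<otimes> xy 1 (j - 1) + (Rho3, iota2) \<otimes> xy (j + 1) (2*n - 1)
       + (Rho123, Rho23) \<otimes> bas (XY (j + 1) 1)"
| "link_delta n (XB i) =
     (iota2, Rho1) \<otimes> xy 1 (i - 1) + (iota2, Rho3) \<otimes> xy (i + 1) (2*n - 1)
       + (Rho23, Rho123) \<otimes> bas (XY 1 (i + 1))"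
| "link_delta n AB =
     (Rho1, Rho3) \<otimes> xy 1 (2*n - 1) + (Rho3, Rho1) \<otimes> xy 1 (2*n - 1)
       + (Rho123, Rho123) \<otimes> bas (XY 1 1)"

text \<open>The summand \<open>CFDD(H, 0)\<close> of the complement of the \<open>(2, 2n)\<close>-torus link.\<close>

definition link_DD :: "nat \<Rightarrow> (gen \<Rightarrow> bit) dd" where
  "link_DD n = dd_of (link_gens n) (link_delta n)"

definition small_gens :: "nat \<Rightarrow> gen set" where
  "small_gens n =
     {AB} \<union>
     {AY (2*k) | k. 1 \<le> k \<and> k \<le> n - 1} \<union>
     {XB (2*k) | k. 1 \<le> k \<and> k \<le> n - 1} \<union>
     {XY k k | k. 1 \<le> k \<and> k \<le> 2*n - 1}"

text \<open>\<open>small_delta n\<close> is only used on \<open>small_gens n\<close>, where the index \<open>m\<close> of \<open>AY m\<close> and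
  \<open>XB m\<close> is even and the two indices of \<open>XY\<close> agree.\<close>

fun small_delta :: "nat \<Rightarrow> gen \<Rightarrow> (gen \<Rightarrow> bit) tensor" where
  "small_delta n AB =
     (Rho123, Rho123) \<otimes> bas (XY 1 1)
       + (Rho1, Rho3) \<otimes> bas (XY n n) + (Rho3, Rho1) \<otimes> bas (XY n n)"
| "small_delta n (AY m) =
     (let k = m div 2 in
       (Rho1, iota2) \<otimes> bas (XY k k) + (Rho3, iota2) \<otimes> bas (XY (n + k) (n + k)))"
| "small_delta n (XB m) =
     (let k = m div 2 in
       (iota2, Rho1) \<otimes> bas (XY k k) + (iota2, Rho3) \<otimes> bas (XY (n + k) (n + k))
         + (Rho23, Rho123) \<otimes> bas (XY (k + 1) (k + 1)))"
| "small_delta n (XY k l) =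
     (if k \<le> n - 1 then 0
      else if k \<le> 2*n - 2 then
        (Rho2, Rho23) \<otimes> bas (AY (2 * (k - n + 1))) + (Rho23, Rho2) \<otimes> bas (XB (2 * (k - n + 1)))
      else (Rho2, Rho2) \<otimes> bas AB)"

definition small_DD :: "nat \<Rightarrow> (gen \<Rightarrow> bit) dd" where
  "small_DD n = dd_of (small_gens n) (small_delta n)"

end

theory Submission
  imports Defs
begin

text \<open>
  The arrows of \<open>\<delta>\<^sup>1\<close> without algebra coefficients preserve \<open>i + j\<close> on the generators
  \<open>x\<^sub>iy\<^sub>j\<close>. For fixed \<open>i + j = 2k\<close> their homology is a line spanned by the outermost
  \<open>xy(i, j)\<close>, namely \<open>xy(1, 2k - 1)\<close> for \<open>k \<le> n\<close> and \<open>xy(2k - 2n + 1, 2n - 1)\<close> for \<open>k \<ge> n\<close>,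
  which becomes the generator \<open>x\<^sub>ky\<^sub>k\<close> of the small structure. The contraction of the
  complement that sends each other \<open>xy(i, j)\<close>, \<open>i \<le> j\<close>, to \<open>x\<^sub>j\<^sub>+\<^sub>1y\<^sub>i\<^sub>-\<^sub>1\<close> and kills \<open>x\<^sub>iy\<^sub>j\<close> for \<open>i > j\<close>
  feeds the homological perturbation lemma, whose series stop after one correction
  term because \<open>\<rho>\<^sub>2\<^sub>3\<rho>\<^sub>2\<^sub>3 = 0\<close>. The resulting maps form a strong deformation
  retraction.
\<close>

section \<open>Linear extensions of maps given on generators\<close>

text \<open>Characteristic two. The second equation cancels a repeated summand inside a longer sum,
  which is how terms pair off in the generator computations.\<close>

lemma tensor_add_self [simp]:
  fixes \<phi> :: "'a \<Rightarrow> 'b \<Rightarrow> bit"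
  shows "\<phi> + \<phi> = 0" "\<phi> + (\<phi> + \<psi>) = \<psi>"
  by (simp_all add: fun_eq_iff)

text \<open>Coefficients stay in ring notation, so that distributivity and the laws of finite sums
  apply to them.\<close>

declare add_bit_eq_xor [simp del] mult_bit_eq_and [simp del]

text \<open>The formula for \<open>delta\<close> in \<open>dd_of\<close>, freed from equal source
  and target, so that morphisms and homotopies are also given by values on generators.\<close>

definition lin :: "gen set \<Rightarrow> (gen \<Rightarrow> (gen \<Rightarrow> bit) tensor) \<Rightarrow> (gen \<Rightarrow> bit) \<Rightarrow> (gen \<Rightarrow> bit) tensor" where
  "lin S f = (\<lambda>v p h. \<Sum>g\<in>S. v g * f g p h)"

text \<open>Applies \<open>f\<close> to the module factor of a tensor and multiplies the algebra
  factors. Composing with \<open>lin T f\<close> amounts to applying \<open>push T f\<close> to the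
  values of the preceding map.\<close>

definition push :: "gen set \<Rightarrow> (gen \<Rightarrow> (gen \<Rightarrow> bit) tensor) \<Rightarrow> (gen \<Rightarrow> bit) tensor \<Rightarrow> (gen \<Rightarrow> bit) tensor" where
  "push T f \<phi> = mu (\<lambda>p q. lin T f (\<phi> p) q)"

definition lmul :: "torus \<times> torus \<Rightarrow> (gen \<Rightarrow> bit) tensor \<Rightarrow> (gen \<Rightarrow> bit) tensor" where
  "lmul p \<phi> = (\<lambda>r. \<Sum>q | mult2 p q = Some r. \<phi> q)"

lemma delta_dd_of [simp]: "delta (dd_of S d) = lin S d"
  by (simp add: dd_of_def lin_def)

lemma sum_fun_apply: "(\<Sum>a\<in>A. f a) x = (\<Sum>a\<in>A. f a x)"
  by (induction A rule: infinite_finite_induct) auto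

lemma push_apply:
  "push T f \<phi> r h = (\<Sum>(p, q) | mult2 p q = Some r. \<Sum>g\<in>T. \<phi> p g * f g q h)"
  by (simp add: push_def mu_def lin_def sum_fun_apply case_prod_unfold)

lemma push_add: "push T f (\<phi> + \<psi>) = push T f \<phi> + push T f \<psi>"
  by (simp add: fun_eq_iff push_apply distrib_right sum.distrib case_prod_unfold)

lemma push_zero: "push T f 0 = 0"
  by (simp add: fun_eq_iff push_apply)

lemma push_zero_map: "push T (\<lambda>_. 0) \<phi> = 0"
  by (simp add: fun_eq_iff push_apply)

lemma lmul_add: "lmul p (\<phi> + \<psi>) = lmul p \<phi> + lmul p \<psi>"
  by (simp add: lmul_def fun_eq_iff sum.distrib sum_fun_apply)

lemma lmul_zero: "lmul p 0 = 0"
  by (simp add: lmul_def fun_eq_iff)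

lemma pure_add: "p \<otimes> (u + v) = p \<otimes> u + p \<otimes> (v :: gen \<Rightarrow> bit)"
  by (simp add: pure_tensor_def fun_eq_iff)

lemma lmul_pure:
  "lmul p (q \<otimes> v) = (case mult2 p q of Some r \<Rightarrow> r \<otimes> v | None \<Rightarrow> 0)"
proof
  fix r
  have "lmul p (q \<otimes> v) r = (\<Sum>q' | mult2 p q' = Some r. if q' = q then v else 0)"
    by (simp add: lmul_def pure_tensor_def)
  also have "\<dots> = (if mult2 p q = Some r then v else 0)"
    by (simp add: sum.delta)
  also have "\<dots> = (case mult2 p q of Some r \<Rightarrow> r \<otimes> v | None \<Rightarrow> 0) r"
    by (auto simp: pure_tensor_def split: option.split)
  finally show "lmul p (q \<otimes> v) r = (case mult2 p q of Some r \<Rightarrow> r \<otimes> v | None \<Rightarrow> 0) r" .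
qed

text \<open>With additivity and \<open>lmul_pure\<close>, this reduces every composite on a
  generator to products of torus basis elements.\<close>

lemma push_pure_bas:
  assumes "finite T" "g \<in> T"
  shows "push T f (p \<otimes> bas g) = lmul p (f g)"
proof (intro ext)
  fix r h
  have "push T f (p \<otimes> bas g) r h =
      (\<Sum>x | mult2 (fst x) (snd x) = Some r. if fst x = p then f g (snd x) h else 0)"
    unfolding push_apply
  proof (rule sum.cong)
    fix x :: "(torus \<times> torus) \<times> torus \<times> torus"
    obtain p' q where x: "x = (p', q)" by (cases x)
    have "(\<Sum>g'\<in>T. (p \<otimes> bas g) p' g' * f g' q h) =
        (\<Sum>g'\<in>T. if g' = g then if p' = p then f g q h else 0 else 0)"
      by (rule sum.cong) (auto simp: pure_tensor_def bas_def)
    then show "(case x of (p', q) \<Rightarrow> \<Sum>g'\<in>T. (p \<otimes> bas g) p' g' * f g' q h) =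
        (if fst x = p then f g (snd x) h else 0)"
      using assms by (simp add: x sum.delta)
  qed auto
  \<comment> \<open>Pairs whose first factor differs from \<open>p\<close> contribute zero, which
    leaves a single slice.\<close>
  also have "\<dots> = (\<Sum>x\<in>{p} \<times> {q. mult2 p q = Some r}. f g (snd x) h)"
    by (rule sum.mono_neutral_cong_right) auto
  also have "\<dots> = lmul p (f g) r h"
    by (simp add: lmul_def sum_fun_apply sum.cartesian_product' flip: sum.cartesian_product)
  finally show "push T f (p \<otimes> bas g) r h = lmul p (f g) r h" .
qed

text \<open>An exchange of finite sums. Because of it, equations between composites may be verified
  on generators.\<close>

lemma lin_comp: "lin T f \<odot> lin S d = lin S (\<lambda>g. push T f (d g))"
proof (intro ext)
  fix x r h
  have "(lin T f \<odot> lin S d) x r h = (\<Sum>(p, q) | mult2 p q = Some r. \<Sum>g'\<in>T. \<Sum>g\<in>S. x g * (d g p g' * f g' q h))"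
    by (simp add: dd_comp_def mu_def lin_def sum_fun_apply case_prod_unfold sum_distrib_right mult.assoc)
  also have "\<dots> = (\<Sum>(p, q) | mult2 p q = Some r. \<Sum>g\<in>S. \<Sum>g'\<in>T. x g * (d g p g' * f g' q h))"
    by (subst sum.swap) simp
  also have "\<dots> = (\<Sum>g\<in>S. \<Sum>(p, q) | mult2 p q = Some r. \<Sum>g'\<in>T. x g * (d g p g' * f g' q h))"
    unfolding case_prod_unfold by (rule sum.swap)
  also have "\<dots> = lin S (\<lambda>g. push T f (d g)) x r h"
    by (simp add: lin_def push_apply sum_distrib_left case_prod_unfold)
  finally show "(lin T f \<odot> lin S d) x r h = lin S (\<lambda>g. push T f (d g)) x r h" .
qed

lemma lin_add_map: "lin S d x + lin S e x = lin S (\<lambda>g. d g + e g) x"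
  by (simp add: lin_def fun_eq_iff distrib_left sum.distrib)

lemma lin_cong: "(\<And>g. g \<in> S \<Longrightarrow> d g = e g) \<Longrightarrow> lin S d = lin S e"
  by (simp add: lin_def fun_eq_iff)

lemma lin_zero_map: "lin S (\<lambda>_. 0) = (\<lambda>_. 0)"
  by (simp add: lin_def fun_eq_iff)

text \<open>The summand of \<open>1\<close> that fixes \<open>g\<close>, hence the only one
  surviving in \<open>1 \<otimes> g\<close>.\<close>

definition gen_one :: "gen \<Rightarrow> torus \<times> torus" where
  "gen_one g = (Idem (fst (gen_idem g)), Idem (snd (gen_idem g)))"

lemma dd_id_eq_lin:
  assumes "finite S" "x \<in> carr (dd_of S d)"
  shows "dd_id (dd_of S d) x = lin S (\<lambda>g. gen_one g \<otimes> bas g) x"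
proof (intro ext)
  fix p h
  have "lin S (\<lambda>g. gen_one g \<otimes> bas g) x p h =
      (\<Sum>g\<in>S. if g = h then (if p = gen_one h then x h else 0) else 0)"
    unfolding lin_def by (rule sum.cong) (auto simp: pure_tensor_def bas_def)
  also have "\<dots> = (if p = gen_one h then x h else 0)"
    \<comment> \<open>Coordinates of \<open>x\<close> outside \<open>S\<close> vanish, so a sum over
      \<open>S\<close> misses nothing.\<close>
    using assms by (auto simp: dd_of_def)
  also have "\<dots> = dd_id (dd_of S d) x p h"
    by (auto simp: dd_id_def dd_of_def gen_one_def split: prod.splits torus.splits)
  finally show "dd_id (dd_of S d) x p h = lin S (\<lambda>g. gen_one g \<otimes> bas g) x p h" by simp
qed

lemma bimodule_dd_of: "bimodule (dd_of S d)"
proof -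
  interpret vector_space "\<lambda>c (v :: gen \<Rightarrow> bit) g. c * v g"
    by unfold_locales (auto simp: fun_eq_iff algebra_simps)
  have "vector_space (\<lambda>c (v :: gen \<Rightarrow> bit) g. c * v g)" ..
  moreover have "subspace {v. \<forall>g. g \<notin> S \<longrightarrow> v g = 0}"
    by (auto simp: subspace_def)
  moreover have "e = Iota2" if "e \<noteq> Iota1" for e
    using that by (cases e) auto
  ultimately show ?thesis
    by (auto simp: bimodule_def dd_of_def idem_action_def fun_eq_iff)
qed

text \<open>A term \<open>a \<otimes> b \<otimes> h\<close> lives over the idempotents only if
  \<open>h\<close> is fixed by the right idempotents of \<open>a\<close> and \<open>b\<close>;
  \<open>i\<close> is the idempotent pair of the source generator.\<close>

definition idem_compatible :: "gen set \<Rightarrow> idem \<times> idem \<Rightarrow> (gen \<Rightarrow> bit) tensor \<Rightarrow> bool" where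
  "idem_compatible T i \<phi> \<longleftrightarrow> (\<forall>a b h. \<phi> (a, b) h \<noteq> 0 \<longrightarrow>
     h \<in> T \<and> gen_idem h = (right_idem a, right_idem b) \<and> (left_idem a, left_idem b) = i)"

lemma compat_add:
  assumes "idem_compatible T i \<phi>" "idem_compatible T i \<psi>"
  shows "idem_compatible T i (\<phi> + \<psi>)"
  unfolding idem_compatible_def
proof (intro allI impI)
  fix a b h
  assume "(\<phi> + \<psi>) (a, b) h \<noteq> 0"
  then have "\<phi> (a, b) h \<noteq> 0 \<or> \<psi> (a, b) h \<noteq> 0"
    by (auto simp del: bit_not_zero_iff)
  then show "h \<in> T \<and> gen_idem h = (right_idem a, right_idem b) \<and> (left_idem a, left_idem b) = i"
    using assms unfolding idem_compatible_def by blast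
qed

lemma compat_zero: "idem_compatible T i 0"
  by (simp add: idem_compatible_def)

lemma compat_pure_bas:
  "idem_compatible T i ((a, b) \<otimes> bas g) \<longleftrightarrow>
     g \<in> T \<and> gen_idem g = (right_idem a, right_idem b) \<and> (left_idem a, left_idem b) = i"
  by (auto simp: idem_compatible_def pure_tensor_def bas_def)

lemma dd_map_lin:
  assumes "\<And>g. g \<in> S \<Longrightarrow> idem_compatible T (gen_idem g) (f g)"
  shows "dd_map (dd_of S d) (dd_of T e) (lin S f)"
proof -
  have nz: "h \<in> T \<and> gen_idem h = (right_idem a, right_idem b) \<and> gen_idem g = (left_idem a, left_idem b)"
    if "f g (a, b) h \<noteq> 0" "g \<in> S" for g a b h
    using assms[of g] that by (force simp: idem_compatible_def)
  have z: "lin S f x (a, b) h = 0"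
    if "\<not> (h \<in> T \<and> gen_idem h = (right_idem a, right_idem b))" for x a b h
    unfolding lin_def by (rule sum.neutral) (use nz that in force)
  have carr: "lin S f x \<in> tensor_carr (dd_of T e)" for x
    using z by (force simp: tensor_carr_def dd_of_def fun_eq_iff)
  \<comment> \<open>By \<open>nz\<close>, a nonzero coefficient forces the idempotents of
    \<open>g\<close> to be the left idempotents of the algebra factors. Selecting generators by
    idempotent therefore equals selecting algebra elements by left idempotent.\<close>
  have L: "lin S f (\<lambda>g. if fst (gen_idem g) = i then x g else 0) = tensor_actL i (lin S f x)" for i x
  proof (intro ext)
    fix p :: "torus \<times> torus" and h
    obtain a b where p: "p = (a, b)" by force
    have "lin S f (\<lambda>g. if fst (gen_idem g) = i then x g else 0) p h =
       (\<Sum>g\<in>S. if left_idem a = i then x g * f g p h else 0)"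
      unfolding lin_def
    proof (rule sum.cong[OF refl])
      fix g assume "g \<in> S"
      then show "(if fst (gen_idem g) = i then x g else 0) * f g p h =
          (if left_idem a = i then x g * f g p h else 0)"
        using nz[of g a b h] by (cases "f g p h = 0") (auto simp: p)
    qed
    then show "lin S f (\<lambda>g. if fst (gen_idem g) = i then x g else 0) p h = tensor_actL i (lin S f x) p h"
      by (simp add: tensor_actL_def lin_def p)
  qed
  have R: "lin S f (\<lambda>g. if snd (gen_idem g) = i then x g else 0) = tensor_actR i (lin S f x)" for i x
  proof (intro ext)
    fix p :: "torus \<times> torus" and h
    obtain a b where p: "p = (a, b)" by force
    have "lin S f (\<lambda>g. if snd (gen_idem g) = i then x g else 0) p h =
       (\<Sum>g\<in>S. if left_idem b = i then x g * f g p h else 0)"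
      unfolding lin_def
    proof (rule sum.cong[OF refl])
      fix g assume "g \<in> S"
      then show "(if snd (gen_idem g) = i then x g else 0) * f g p h =
          (if left_idem b = i then x g * f g p h else 0)"
        using nz[of g a b h] by (cases "f g p h = 0") (auto simp: p)
    qed
    then show "lin S f (\<lambda>g. if snd (gen_idem g) = i then x g else 0) p h = tensor_actR i (lin S f x) p h"
      by (simp add: tensor_actR_def lin_def p)
  qed
  show ?thesis
    unfolding dd_map_def using carr L R
    by (auto simp: dd_of_def)
       (auto simp: lin_def fun_eq_iff distrib_right sum.distrib sum_distrib_left mult.assoc)
qed

section \<open>Type-DD structures, homomorphisms and homotopies checked on generators\<close>

lemma type_DD_dd_of:
  assumes "\<And>g. g \<in> S \<Longrightarrow> idem_compatible S (gen_idem g) (d g)"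
    and "\<And>g. g \<in> S \<Longrightarrow> push S d (d g) = 0"
  shows "type_DD (dd_of S d)"
proof -
  have "lin S d \<odot> lin S d = (\<lambda>_. 0)"
    unfolding lin_comp lin_zero_map[symmetric, of S] by (rule lin_cong) (rule assms)
  then show ?thesis
    using assms by (simp add: type_DD_def bimodule_dd_of dd_map_lin)
qed

lemma dd_hom_lin:
  assumes "\<And>g. g \<in> S \<Longrightarrow> idem_compatible T (gen_idem g) (f g)"
    and "\<And>g. g \<in> S \<Longrightarrow> push T e (f g) + push S f (d g) = 0"
  shows "dd_hom (dd_of S d) (dd_of T e) (lin S f)"
proof -
  have "lin S (\<lambda>g. push T e (f g) + push S f (d g)) = (\<lambda>_. 0)"
    unfolding lin_zero_map[symmetric, of S] by (rule lin_cong) (rule assms)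
  then show ?thesis
    using assms by (simp add: dd_hom_def dd_map_lin lin_comp lin_add_map)
qed

lemma dd_homotopic_lin_id:
  assumes "finite S"
    and "\<And>g. g \<in> S \<Longrightarrow> idem_compatible S (gen_idem g) (h g)"
    and "\<And>g. g \<in> S \<Longrightarrow> push T f' (f g) + gen_one g \<otimes> bas g = push S d (h g) + push S h (d g)"
  shows "dd_homotopic (dd_of S d) (dd_of S d) (lin T f' \<odot> lin S f) (dd_id (dd_of S d))"
  unfolding dd_homotopic_def
proof (intro exI conjI ballI)
  show "dd_map (dd_of S d) (dd_of S d) (lin S h)"
    using assms by (simp add: dd_map_lin)
  fix x assume x: "x \<in> carr (dd_of S d)"
  have "lin S (\<lambda>g. push T f' (f g) + gen_one g \<otimes> bas g) =
      lin S (\<lambda>g. push S d (h g) + push S h (d g))"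
    by (rule lin_cong) (rule assms)
  then show "(lin T f' \<odot> lin S f) x + dd_id (dd_of S d) x =
      (delta (dd_of S d) \<odot> lin S h) x + (lin S h \<odot> delta (dd_of S d)) x"
    by (simp add: lin_comp lin_add_map dd_id_eq_lin[OF assms(1) x])
qed

lemmas tensor_simps = push_add push_zero lmul_add lmul_zero pure_add lmul_pure mult2_def

section \<open>The structure of the link complement\<close>

lemma mem_link_gens:
  "AB \<in> link_gens n"
  "AY k \<in> link_gens n \<longleftrightarrow> even k \<and> 2 \<le> k \<and> k \<le> 2*n - 2"
  "XB k \<in> link_gens n \<longleftrightarrow> even k \<and> 2 \<le> k \<and> k \<le> 2*n - 2"
  "XY i j \<in> link_gens n \<longleftrightarrow> 1 \<le> i \<and> i \<le> 2*n - 1 \<and> 1 \<le> j \<and> j \<le> 2*n - 1 \<and> even (i + j)"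
  by (auto simp: link_gens_def)

lemma mem_small_gens:
  "AB \<in> small_gens n"
  "AY k \<in> small_gens n \<longleftrightarrow> even k \<and> 2 \<le> k \<and> k \<le> 2*n - 2"
  "XB k \<in> small_gens n \<longleftrightarrow> even k \<and> 2 \<le> k \<and> k \<le> 2*n - 2"
  "XY k l \<in> small_gens n \<longleftrightarrow> l = k \<and> 1 \<le> k \<and> k \<le> 2*n - 1"
  by (auto simp: small_gens_def elim!: evenE)

lemma finite_link_gens: "finite (link_gens n)"
proof (rule finite_subset)
  show "link_gens n \<subseteq>
      {AB} \<union> AY ` {..2*n} \<union> XB ` {..2*n} \<union> (\<lambda>(i, j). XY i j) ` ({..2*n} \<times> {..2*n})"
    by (force simp: link_gens_def)
qed auto

lemma finite_small_gens: "finite (small_gens n)"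
  by (rule finite_subset[OF _ finite_link_gens[of n]]) (auto simp: small_gens_def mem_link_gens)

lemmas push_link = push_pure_bas[OF finite_link_gens]
lemmas push_small = push_pure_bas[OF finite_small_gens]

lemma xy_commute: "xy i j = xy j i"
  by (auto simp: xy_def add.commute)

lemma XY_commute_mem: "XY i j \<in> link_gens n \<Longrightarrow> XY j i \<in> link_gens n"
  by (simp add: mem_link_gens add.commute)

lemma push_link_xy:
  assumes "XY i j \<in> link_gens n"
  shows "push (link_gens n) f (p \<otimes> xy i j) =
    lmul p (if i = j then f (XY i i) else f (XY i j) + f (XY j i))"
  using assms XY_commute_mem[OF assms] by (auto simp: xy_def tensor_simps push_link)

lemma compat_link_xy:
  assumes "XY i j \<in> link_gens n"
  shows "idem_compatible (link_gens n) e ((a, b) \<otimes> xy i j) \<longleftrightarrow>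
    (right_idem a, right_idem b) = (Iota2, Iota2) \<and> (left_idem a, left_idem b) = e"
proof (cases "i = j")
  case True
  then show ?thesis using assms by (auto simp: xy_def compat_pure_bas)
next
  case False
  then have *: "(p \<otimes> xy i j) p (XY i j) \<noteq> 0" for p
    by (simp add: xy_def pure_tensor_def bas_def)
  have "idem_compatible (link_gens n) e ((a, b) \<otimes> xy i j)"
    if "(right_idem a, right_idem b) = (Iota2, Iota2) \<and> (left_idem a, left_idem b) = e"
    using that False assms XY_commute_mem[OF assms]
    by (auto simp: xy_def pure_add intro!: compat_add simp: compat_pure_bas)
  moreover have "(right_idem a, right_idem b) = (Iota2, Iota2) \<and> (left_idem a, left_idem b) = e"
    if "idem_compatible (link_gens n) e ((a, b) \<otimes> xy i j)"
    using that *[of "(a, b)"] unfolding idem_compatible_def by (metis gen_idem.simps(4))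
  ultimately show ?thesis by blast
qed

text \<open>At the boundary the coefficient-free term keeps its generic shape, since
  \<open>2*n - 2\<close> is the predecessor of \<open>2*n - 1\<close>; only the term with algebra
  coefficients changes.\<close>

lemma link_delta_XY:
  "i < j \<Longrightarrow> j < 2*n - 1 \<Longrightarrow> link_delta n (XY i j) =
     (iota2, iota2) \<otimes> xy (Suc i) (j - 1) + (Rho23, Rho23) \<otimes> bas (XY (Suc i) (Suc j))"
  "j < i \<Longrightarrow> i < 2*n - 1 \<Longrightarrow> link_delta n (XY i j) =
     (iota2, iota2) \<otimes> xy (i - 1) (Suc j) + (Rho23, Rho23) \<otimes> bas (XY (Suc i) (Suc j))"
  "i < 2*n - 1 \<Longrightarrow> link_delta n (XY i i) = (Rho23, Rho23) \<otimes> bas (XY (Suc i) (Suc i))"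
  "i < j \<Longrightarrow> j = 2*n - 1 \<Longrightarrow> link_delta n (XY i j) =
     (iota2, iota2) \<otimes> xy (Suc i) (j - 1) + (Rho23, Rho2) \<otimes> bas (XB (Suc i))"
  "j < i \<Longrightarrow> i = 2*n - 1 \<Longrightarrow> link_delta n (XY i j) =
     (iota2, iota2) \<otimes> xy (i - 1) (Suc j) + (Rho2, Rho23) \<otimes> bas (AY (Suc j))"
  "i = 2*n - 1 \<Longrightarrow> link_delta n (XY i i) = (Rho2, Rho2) \<otimes> bas AB"
proof -
  have "2*n - Suc (Suc 0) = 2*n - 2" by simp
  then show "i < j \<Longrightarrow> j = 2*n - 1 \<Longrightarrow> link_delta n (XY i j) =
      (iota2, iota2) \<otimes> xy (Suc i) (j - 1) + (Rho23, Rho2) \<otimes> bas (XB (Suc i))"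
    and "j < i \<Longrightarrow> i = 2*n - 1 \<Longrightarrow> link_delta n (XY i j) =
      (iota2, iota2) \<otimes> xy (i - 1) (Suc j) + (Rho2, Rho23) \<otimes> bas (AY (Suc j))"
    by simp_all
qed simp_all

text \<open>The coefficient-free parts of the two members of \<open>xy i j\<close> are
  \<open>xy (Suc i) (j - 1)\<close> and its mirror image, which are equal and cancel:
  \<open>xy i j\<close> is a cycle for the coefficient-free arrows.\<close>

lemma push_delta_xy:
  assumes "XY i j \<in> link_gens n" "i < 2*n - 1" "j < 2*n - 1"
  shows "push (link_gens n) (link_delta n) (p \<otimes> xy i j) =
    lmul p ((Rho23, Rho23) \<otimes> xy (Suc i) (Suc j))"
proof -
  have *: "link_delta n (XY i j) + link_delta n (XY j i) = (Rho23, Rho23) \<otimes> xy (Suc i) (Suc j)"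
    if "i < j" "j < 2*n - 1" for i j
    using that by (simp add: link_delta_XY xy_commute[of "j - Suc 0"] add_ac del: link_delta.simps)
      (simp add: xy_def pure_add)
  show ?thesis
  proof (cases i j rule: linorder_cases)
    case less
    then show ?thesis using assms *[of i j] by (simp add: push_link_xy del: link_delta.simps)
  next
    case equal
    then show ?thesis using assms
      by (simp add: link_delta_XY xy_def push_link del: link_delta.simps)
  next
    case greater
    then show ?thesis using assms *[of j i]
      by (simp add: push_link_xy add.commute xy_commute[of "Suc i"] del: link_delta.simps)
  qed
qed

lemma push_delta_xy_last:
  assumes "XY i j \<in> link_gens n" "i < j" "j = 2*n - 1"
  shows "push (link_gens n) (link_delta n) (p \<otimes> xy i j) =
    lmul p ((Rho23, Rho2) \<otimes> bas (XB (Suc i)) + (Rho2, Rho23) \<otimes> bas (AY (Suc i)))"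
proof -
  have "link_delta n (XY i j) + link_delta n (XY j i) =
      (Rho23, Rho2) \<otimes> bas (XB (Suc i)) + (Rho2, Rho23) \<otimes> bas (AY (Suc i))"
    using assms(2,3)
    by (simp add: link_delta_XY xy_commute[of _ "Suc i"] add_ac del: link_delta.simps)
  then show ?thesis
    using assms(2) by (simp add: push_link_xy[OF assms(1)] del: link_delta.simps)
qed

declare link_delta.simps(1) [simp del]

lemma inner_XY_mem:
  assumes "XY i j \<in> link_gens n" "i < j"
  shows "XY (Suc i) (j - Suc 0) \<in> link_gens n" "XY (j - Suc 0) (Suc i) \<in> link_gens n"
  using assms unfolding mem_link_gens by presburger+

lemma outer_XY_mem:
  "1 \<le> n \<Longrightarrow> XY (Suc 0) (Suc 0) \<in> link_gens n"
  "1 \<le> n \<Longrightarrow> XY (Suc 0) (2*n - Suc 0) \<in> link_gens n"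
  "AY k \<in> link_gens n \<Longrightarrow> XY (Suc 0) (k - Suc 0) \<in> link_gens n"
  "AY k \<in> link_gens n \<Longrightarrow> XY (Suc k) (2*n - Suc 0) \<in> link_gens n"
  "AY k \<in> link_gens n \<Longrightarrow> XY (Suc k) (Suc 0) \<in> link_gens n"
  "AY k \<in> link_gens n \<Longrightarrow> XY (Suc 0) (Suc k) \<in> link_gens n"
  unfolding mem_link_gens by presburger+

lemma XB_mem_iff: "XB k \<in> link_gens n \<longleftrightarrow> AY k \<in> link_gens n"
  by (simp add: mem_link_gens)

lemma compat_link_delta:
  assumes "g \<in> link_gens n" "1 \<le> n"
  shows "idem_compatible (link_gens n) (gen_idem g) (link_delta n g)"
proof (cases g)
  case (XY i j)
  note g = assms(1)[unfolded XY mem_link_gens]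
  show ?thesis
  proof (cases i j rule: linorder_cases)
    case less
    then have "XY (Suc i) (j - Suc 0) \<in> link_gens n" using assms XY by (simp add: inner_XY_mem)
    \<comment> \<open>Equal parity and \<open>i < j\<close> give \<open>i + 2 \<le> j\<close>, so
      \<open>Suc i\<close> is a legal index for \<open>XB\<close> when \<open>j\<close> is
      maximal.\<close>
    moreover have "Suc i \<le> 2*n - 2" using less g by presburger
    ultimately show ?thesis using g less unfolding XY
      by (cases "j = 2*n - 1")
        (auto simp: link_delta_XY compat_link_xy compat_pure_bas mem_link_gens intro!: compat_add)
  next
    case equal
    then show ?thesis using g unfolding XY
      by (cases "j = 2*n - 1") (auto simp: link_delta_XY compat_pure_bas mem_link_gens)
  next
    case greater
    then have "XY (i - Suc 0) (Suc j) \<in> link_gens n"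
      using XY_commute_mem[of i j n] assms XY by (simp add: inner_XY_mem)
    moreover have "Suc j \<le> 2*n - 2" using greater g by presburger
    ultimately show ?thesis using g greater unfolding XY
      by (cases "i = 2*n - 1")
        (auto simp: link_delta_XY compat_link_xy compat_pure_bas mem_link_gens intro!: compat_add)
  qed
qed (use assms in \<open>auto simp: compat_link_xy compat_pure_bas mem_link_gens(1) XB_mem_iff outer_XY_mem
    intro!: compat_add\<close>)

text \<open>Most products of coefficients vanish. The surviving composites come in equal pairs, one
  using a coefficient-free arrow and the other, away from a maximal index, using it in the opposite
  order with an algebra arrow.\<close>

lemma link_delta_squared:
  assumes "g \<in> link_gens n" "2 \<le> n"
  shows "push (link_gens n) (link_delta n) (link_delta n g) = 0"
proof (cases g)
  case AB
  then show ?thesis using assms(2)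
    by (simp add: tensor_simps push_link push_delta_xy_last mem_link_gens link_delta_XY)
next
  case (AY j)
  note g = assms(1)[unfolded AY mem_link_gens]
  \<comment> \<open>\<open>Rho3\<close> times \<open>Rho2\<close> or \<open>Rho23\<close> is zero.
    For \<open>j + 1 = 2*n - 1\<close> the element \<open>xy\<close> is a single diagonal generator
    and maps to \<open>AB\<close> instead.\<close>
  have "push (link_gens n) (link_delta n) ((Rho3, iota2) \<otimes> xy (j + 1) (2*n - 1)) = 0"
  proof (cases "j + 1 = 2*n - 1")
    case True
    then show ?thesis
      by (simp add: xy_def push_link mem_link_gens link_delta_XY tensor_simps)
  next
    case False
    then have "j + 1 < 2*n - 1" using g by linarith
    then show ?thesis
      using g by (simp add: push_delta_xy_last mem_link_gens tensor_simps)
  qed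
  \<comment> \<open>This composite comes from \<open>Rho1\<close> times \<open>Rho23\<close>; the
    next one follows \<open>Rho123\<close> with a coefficient-free arrow. They agree and
    cancel.\<close>
  moreover have "push (link_gens n) (link_delta n) ((Rho1, iota2) \<otimes> xy 1 (j - 1)) =
      (Rho123, Rho23) \<otimes> xy 2 j"
  proof -
    have "XY 1 (j - 1) \<in> link_gens n" using g unfolding mem_link_gens by presburger
    moreover have "Suc (j - 1) = j" "j - 1 < 2*n - 1" "1 < 2*n - 1" using g by linarith+
    ultimately show ?thesis
      by (simp only: push_delta_xy lmul_pure) (simp add: mult2_def numeral_2_eq_2)
  qed
  moreover have "push (link_gens n) (link_delta n) ((Rho123, Rho23) \<otimes> bas (XY (j + 1) 1)) =
      (Rho123, Rho23) \<otimes> xy 2 j"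
  proof -
    have "XY (j + 1) 1 \<in> link_gens n" using g unfolding mem_link_gens by presburger
    moreover have "1 < j + 1"
      "j + 1 = 2*n - 1 \<and> n + n - Suc (Suc 0) = j \<or> j + 1 < 2*n - 1" using g by linarith+
    then have "lmul (Rho123, Rho23) (link_delta n (XY (j + 1) 1)) = (Rho123, Rho23) \<otimes> xy j 2"
      using link_delta_XY(5)[of 1 "j + 1" n] link_delta_XY(2)[of 1 "j + 1" n]
      by (auto simp: lmul_add lmul_pure mult2_def numeral_2_eq_2)
    ultimately show ?thesis
      by (simp only: push_link xy_commute[of j])
  qed
  ultimately show ?thesis
    by (simp add: AY push_add)
next
  case (XB j)
  note g = assms(1)[unfolded XB mem_link_gens]
  have "push (link_gens n) (link_delta n) ((iota2, Rho3) \<otimes> xy (j + 1) (2*n - 1)) = 0"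
  proof (cases "j + 1 = 2*n - 1")
    case True
    then show ?thesis
      by (simp add: xy_def push_link mem_link_gens link_delta_XY tensor_simps)
  next
    case False
    then have "j + 1 < 2*n - 1" using g by linarith
    then show ?thesis
      using g by (simp add: push_delta_xy_last mem_link_gens tensor_simps)
  qed
  moreover have "push (link_gens n) (link_delta n) ((iota2, Rho1) \<otimes> xy 1 (j - 1)) =
      (Rho23, Rho123) \<otimes> xy 2 j"
  proof -
    have "XY 1 (j - 1) \<in> link_gens n" using g unfolding mem_link_gens by presburger
    moreover have "Suc (j - 1) = j" "j - 1 < 2*n - 1" "1 < 2*n - 1" using g by linarith+
    ultimately show ?thesis
      by (simp only: push_delta_xy lmul_pure) (simp add: mult2_def numeral_2_eq_2)
  qed
  moreover have "push (link_gens n) (link_delta n) ((Rho23, Rho123) \<otimes> bas (XY 1 (j + 1))) =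
      (Rho23, Rho123) \<otimes> xy 2 j"
  proof -
    have "XY 1 (j + 1) \<in> link_gens n" using g unfolding mem_link_gens by presburger
    moreover have "1 < j + 1"
      "j + 1 = 2*n - 1 \<and> n + n - Suc (Suc 0) = j \<or> j + 1 < 2*n - 1" using g by linarith+
    then have "lmul (Rho23, Rho123) (link_delta n (XY 1 (j + 1))) = (Rho23, Rho123) \<otimes> xy 2 j"
      using link_delta_XY(4)[of 1 "j + 1" n] link_delta_XY(1)[of 1 "j + 1" n]
      by (auto simp: lmul_add lmul_pure mult2_def numeral_2_eq_2)
    ultimately show ?thesis
      by (simp only: push_link xy_commute[of j])
  qed
  ultimately show ?thesis
    by (simp add: XB push_add)
next
  case (XY i j)
  note g = assms(1)[unfolded XY mem_link_gens]
  show ?thesis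
  proof (cases i j rule: linorder_cases)
    case less
    have b: "Suc i \<le> 2*n - 2" using less g by presburger
    have e1: "push (link_gens n) (link_delta n) ((iota2, iota2) \<otimes> xy (Suc i) (j - 1)) =
        (Rho23, Rho23) \<otimes> xy (Suc (Suc i)) j"
      using less g b assms(1) inner_XY_mem(1)[of i j n]
      by (subst push_delta_xy) (auto simp: XY lmul_pure mult2_def)
    show ?thesis
    proof (cases "j = 2*n - 1")
      case True
      \<comment> \<open>In the last column the algebra arrow ends at \<open>XB (Suc i)\<close>. Its
        \<open>Rho3\<close> arrow on the right factor, composed with \<open>Rho2\<close>, gives the
        term that cancels \<open>e1\<close>; its other arrows give zero products.\<close>
      have "XB (Suc i) \<in> link_gens n"
        using g b True unfolding mem_link_gens by presburger
      then have "push (link_gens n) (link_delta n) ((Rho23, Rho2) \<otimes> bas (XB (Suc i))) =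
          (Rho23, Rho23) \<otimes> xy (Suc (Suc i)) j"
        using True by (simp add: push_link tensor_simps)
      then show ?thesis
        unfolding XY link_delta_XY(4)[OF less True] push_add e1 by simp
    next
      case False
      then have j: "j < 2*n - 1" using g by linarith
      then have q: "Suc j = 2*n - 1 \<and> 2*n - Suc (Suc 0) = j \<or> Suc j < 2*n - 1" by linarith
      have "XY (Suc i) (Suc j) \<in> link_gens n"
        using g j less by (simp add: mem_link_gens)
      moreover have "lmul (Rho23, Rho23) (link_delta n (XY (Suc i) (Suc j))) =
          (Rho23, Rho23) \<otimes> xy (Suc (Suc i)) j"
        using less j link_delta_XY(1,4)[of "Suc i" "Suc j" n]
          q by (auto simp: tensor_simps)
      ultimately show ?thesis
        unfolding XY link_delta_XY(1)[OF less j] push_add e1 by (simp add: push_link)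
    qed
  next
    case equal
    \<comment> \<open>From the diagonal all products of coefficients vanish; the split only follows
      the shapes of the two successive arrows.\<close>
    consider "j = 2*n - 1" | "Suc j = 2*n - 1" | "Suc j < 2*n - 1" using g by linarith
    then show ?thesis using g equal unfolding XY
      by cases (simp_all add: link_delta_XY push_delta_xy push_link mem_link_gens tensor_simps)
  next
    case greater
    have b: "Suc j \<le> 2*n - 2" using greater g by presburger
    have e1: "push (link_gens n) (link_delta n) ((iota2, iota2) \<otimes> xy (i - 1) (Suc j)) =
        (Rho23, Rho23) \<otimes> xy i (Suc (Suc j))"
      using greater g b assms(1) inner_XY_mem(2)[of j i n] XY_commute_mem[of i j n]
      by (subst push_delta_xy) (auto simp: XY lmul_pure mult2_def)
    show ?thesis
    proof (cases "i = 2*n - 1")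
      case True
      have "AY (Suc j) \<in> link_gens n"
        using g b True unfolding mem_link_gens by presburger
      then have "push (link_gens n) (link_delta n) ((Rho2, Rho23) \<otimes> bas (AY (Suc j))) =
          (Rho23, Rho23) \<otimes> xy i (Suc (Suc j))"
        using True by (simp add: push_link tensor_simps xy_commute[of "Suc _"])
      then show ?thesis
        unfolding XY link_delta_XY(5)[OF greater True] push_add e1 by simp
    next
      case False
      then have i: "i < 2*n - 1" using g by linarith
      then have q: "Suc i = 2*n - 1 \<and> 2*n - Suc (Suc 0) = i \<or> Suc i < 2*n - 1" by linarith
      have "XY (Suc i) (Suc j) \<in> link_gens n"
        using g i greater by (simp add: mem_link_gens)
      moreover have "lmul (Rho23, Rho23) (link_delta n (XY (Suc i) (Suc j))) =
          (Rho23, Rho23) \<otimes> xy i (Suc (Suc j))"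
        using greater i link_delta_XY(2,5)[of "Suc j" "Suc i" n]
          q by (auto simp: tensor_simps)
      ultimately show ?thesis
        unfolding XY link_delta_XY(2)[OF greater i] push_add e1 by (simp add: push_link)
    qed
  qed
qed

section \<open>The small structure\<close>

lemma small_delta_XY:
  "k < n \<Longrightarrow> small_delta n (XY k l) = 0"
  "n \<le> k \<Longrightarrow> k < 2*n - 1 \<Longrightarrow> small_delta n (XY k l) =
     (Rho2, Rho23) \<otimes> bas (AY (2 * (k - n + 1))) + (Rho23, Rho2) \<otimes> bas (XB (2 * (k - n + 1)))"
  "n \<ge> 1 \<Longrightarrow> k = 2*n - 1 \<Longrightarrow> small_delta n (XY k l) = (Rho2, Rho2) \<otimes> bas AB"
  by auto

declare small_delta.simps(4) [simp del]

lemma compat_small_delta: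
  assumes "g \<in> small_gens n" "1 \<le> n"
  shows "idem_compatible (small_gens n) (gen_idem g) (small_delta n g)"
proof (cases g)
  case (XY k l)
  consider "k < n" | "n \<le> k" "k < 2*n - 1" | "k = 2*n - 1"
    using assms XY mem_small_gens(4) by fastforce
  then show ?thesis
    using assms(2) unfolding XY
    by cases (auto simp: small_delta_XY compat_zero compat_pure_bas mem_small_gens intro!: compat_add)
qed (use assms in \<open>auto simp: compat_pure_bas mem_small_gens Let_def intro!: compat_add\<close>)

text \<open>The only nonzero products arise from \<open>XY k k\<close> with
  \<open>n \<le> k < 2*n - 1\<close>: the routes through \<open>AY\<close> and \<open>XB\<close>
  both end in \<open>(Rho23, Rho23)\<close> times the generator \<open>XY (k + 1) (k + 1)\<close>
  and cancel.\<close>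

lemma small_delta_squared:
  assumes "g \<in> small_gens n" "2 \<le> n"
  shows "push (small_gens n) (small_delta n) (small_delta n g) = 0"
proof (cases g)
  case AB
  then show ?thesis using assms(2)
    by (simp add: tensor_simps push_small mem_small_gens small_delta_XY)
next
  case (AY m)
  with assms(1) obtain k where k: "m = 2*k" "1 \<le> k" "k < n"
    by (auto simp: mem_small_gens elim!: evenE)
  then have "n + k < 2*n - 1 \<or> n + k = 2*n - 1" by linarith
  with k show ?thesis unfolding AY
    by (auto simp: tensor_simps push_small mem_small_gens small_delta_XY)
next
  case (XB m)
  with assms(1) obtain k where k: "m = 2*k" "1 \<le> k" "k < n"
    by (auto simp: mem_small_gens elim!: evenE)
  then have "n + k < 2*n - 1 \<or> n + k = 2*n - 1" "k + 1 < n \<or> k + 1 = n" by linarith+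
  with k assms(2) show ?thesis unfolding XB
    by (auto simp: tensor_simps push_small mem_small_gens small_delta_XY)
next
  case (XY k l)
  consider "k < n" | d where "k = n + d" "k < 2*n - 1" | "k = 2*n - 1"
    using assms(1) XY mem_small_gens(4) by (metis le_neq_implies_less not_le nat_le_iff_add)
  then show ?thesis
    using assms(2) unfolding XY
    by cases (simp_all add: tensor_simps push_small mem_small_gens small_delta_XY)
qed

section \<open>The deformation retraction\<close>

lemma gen_one_simps [simp]:
  "gen_one AB = (Idem Iota1, Idem Iota1)" "gen_one (AY k) = (Idem Iota1, Idem Iota2)"
  "gen_one (XB k) = (Idem Iota2, Idem Iota1)" "gen_one (XY i j) = (Idem Iota2, Idem Iota2)"
  by (simp_all add: gen_one_def)

text \<open>The coefficient-free part of the differential of \<open>XY (j + 1) (i - 1)\<close> is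
  \<open>xy i j\<close>. This preimage lies below the diagonal, where \<open>homotopy\<close>
  vanishes, and its algebra arrows stay below the diagonal or end at \<open>AY\<close>; hence
  perturbation adds no correction here.\<close>

fun homotopy :: "nat \<Rightarrow> gen \<Rightarrow> (gen \<Rightarrow> bit) tensor" where
  "homotopy n (XY i j) =
     (if 1 < i \<and> i \<le> j \<and> j < 2*n - 1 then (iota2, iota2) \<otimes> bas (XY (j + 1) (i - 1)) else 0)"
| "homotopy n _ = 0"

text \<open>The \<open>AY\<close> clause is the perturbation term: \<open>homotopy\<close> sends
  \<open>XY i (2*n - 2)\<close> to \<open>XY (2*n - 1) (i - 1)\<close>, whose algebra arrow ends at
  \<open>AY i\<close>.\<close>

fun proj :: "nat \<Rightarrow> gen \<Rightarrow> (gen \<Rightarrow> bit) tensor" where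
  "proj n (XY i j) =
     (if i \<le> j \<and> (i = 1 \<or> j = 2*n - 1)
        then (iota2, iota2) \<otimes> bas (XY ((i + j) div 2) ((i + j) div 2))
      else if i \<le> j \<and> j = 2*n - 2 then (Rho2, Rho23) \<otimes> bas (AY i)
      else 0)"
| "proj n g = gen_one g \<otimes> bas g"

text \<open>For \<open>k < n\<close> the algebra arrow carries \<open>xy 1 (2*k - 1)\<close> to
  \<open>xy 2 (2*k)\<close>, and \<open>homotopy\<close> carries this to the correction
  \<open>XY (2*k + 1) 1\<close>. For \<open>k \<ge> n\<close> the arrows leave the \<open>XY\<close>
  generators and no correction arises.\<close>

fun incl :: "nat \<Rightarrow> gen \<Rightarrow> (gen \<Rightarrow> bit) tensor" where
  "incl n (XY k l) =
     (if k < n then (iota2, iota2) \<otimes> xy 1 (2*k - 1) + (Rho23, Rho23) \<otimes> bas (XY (2*k + 1) 1)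
      else (iota2, iota2) \<otimes> xy (2*k - 2*n + 1) (2*n - 1))"
| "incl n g = gen_one g \<otimes> bas g"

lemma compat_homotopy:
  assumes "g \<in> link_gens n"
  shows "idem_compatible (link_gens n) (gen_idem g) (homotopy n g)"
proof (cases g)
  case (XY i j)
  have "XY (Suc j) (i - Suc 0) \<in> link_gens n" if "1 < i" "j < 2*n - 1"
    using assms that unfolding XY mem_link_gens by presburger
  then show ?thesis by (auto simp: XY compat_zero compat_pure_bas)
qed (simp_all add: compat_zero)

lemma compat_proj:
  assumes "g \<in> link_gens n"
  shows "idem_compatible (small_gens n) (gen_idem g) (proj n g)"
proof (cases g)
  case (XY i j)
  have "AY i \<in> small_gens n" if "i \<le> j" "j = 2*n - 2"
    using assms that unfolding XY mem_link_gens mem_small_gens by presburger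
  moreover have "XY ((i + j) div 2) ((i + j) div 2) \<in> small_gens n"
    using assms unfolding XY mem_link_gens mem_small_gens by presburger
  ultimately show ?thesis by (auto simp: XY compat_zero compat_pure_bas)
qed (use assms in \<open>simp_all add: compat_pure_bas mem_small_gens mem_link_gens\<close>)

lemma compat_incl:
  assumes "g \<in> small_gens n"
  shows "idem_compatible (link_gens n) (gen_idem g) (incl n g)"
proof (cases g)
  case (XY k l)
  have "XY (Suc 0) (2*k - Suc 0) \<in> link_gens n \<and> XY (Suc (2*k)) (Suc 0) \<in> link_gens n" if "k < n"
    using assms that unfolding XY mem_link_gens mem_small_gens by presburger
  moreover have "XY (Suc (2*k - 2*n)) (2*n - Suc 0) \<in> link_gens n" if "\<not> k < n"
    using assms that unfolding XY mem_link_gens mem_small_gens by presburger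
  ultimately show ?thesis
    by (auto simp: XY compat_pure_bas compat_link_xy intro!: compat_add)
qed (use assms in \<open>simp_all add: compat_pure_bas mem_small_gens mem_link_gens\<close>)

text \<open>A map that vanishes below the diagonal sees only the upper member of
  \<open>xy i j\<close>.\<close>

lemma push_link_xy_upper:
  assumes "XY i j \<in> link_gens n" "\<And>i j. j < i \<Longrightarrow> f (XY i j) = 0"
  shows "push (link_gens n) f (p \<otimes> xy i j) = lmul p (f (XY (min i j) (max i j)))"
proof (cases i j rule: linorder_cases)
  case less
  then show ?thesis using assms(2)[of i j] by (simp add: push_link_xy[OF assms(1)] assms(2))
next
  case equal
  then show ?thesis using push_link_xy[OF assms(1)] by simp
next
  case greater
  then show ?thesis by (simp add: push_link_xy[OF assms(1)] assms(2))
qed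

lemma push_proj_xy:
  assumes "XY i j \<in> link_gens n"
  shows "push (link_gens n) (proj n) (p \<otimes> xy i j) = lmul p (proj n (XY (min i j) (max i j)))"
  by (rule push_link_xy_upper[OF assms]) simp

lemma push_homotopy_xy:
  assumes "XY i j \<in> link_gens n"
  shows "push (link_gens n) (homotopy n) (p \<otimes> xy i j) = lmul p (homotopy n (XY (min i j) (max i j)))"
  by (rule push_link_xy_upper[OF assms]) simp

text \<open>Parameters that avoid truncated subtraction: \<open>d\<close> is half the distance from
  the diagonal. Cases \<open>low\<close> and \<open>high\<close> survive in homology,
  \<open>pre\<close> is the column carrying the correction of \<open>proj\<close>, and on
  \<open>inner\<close> the map \<open>proj\<close> is zero.\<close>

lemma XY_cases:
  assumes "XY i j \<in> link_gens n" "i \<le> j"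
  obtains (low) d e where "i = 1" "j = 2*d + 1" "n = d + e + 2"
  | (high) d e where "i = 2*e + 1" "j = 2*e + 2*d + 1" "n = e + d + 1"
  | (pre) d e where "i = 2*e + 2" "j = 2*e + 2*d + 2" "n = e + d + 2"
  | (inner) a d where "i = a + 2" "j = a + 2*d + 2" "j < 2*n - 2"
proof -
  obtain d where d: "j = i + 2*d"
  proof -
    have "j = i + 2 * ((j - i) div 2)" using assms unfolding mem_link_gens by presburger
    then show thesis by (rule that)
  qed
  consider "i = 1" "j < 2*n - 1" | "j = 2*n - 1" | "j = 2*n - 2" "i > 1" | "i > 1" "j < 2*n - 2"
    using assms unfolding mem_link_gens by linarith
  then show thesis
  proof cases
    case 1
    then have "n = d + (n - d - 2) + 2" using d by linarith
    then show ?thesis using 1 d low[of d "n - d - 2"] by simp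
  next
    case 2
    then have "i = 2*(n - d - 1) + 1" "n = (n - d - 1) + d + 1"
      using d assms(1) unfolding mem_link_gens by presburger+
    then show ?thesis using d by (intro high[of "n - d - 1" d]) linarith+
  next
    case 3
    then have "i = 2*(n - d - 2) + 2" "n = (n - d - 2) + d + 2"
      using d assms(1) unfolding mem_link_gens by presburger+
    then show ?thesis using d by (intro pre[of "n - d - 2" d]) linarith+
  next
    case 4
    then show ?thesis using d by (intro inner[of "i - 2" d]) linarith+
  qed
qed

lemma even_index_cases:
  fixes m n :: nat
  assumes "even m" "2 \<le> m" "m \<le> 2*n - 2"
  obtains k e where "m = 2*Suc k" "n = k + e + 2"
proof -
  have "m = 2*Suc (m div 2 - 1)" "n = (m div 2 - 1) + (n - m div 2 - 1) + 2"
    using assms by presburger+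
  then show thesis by (rule that)
qed

text \<open>Here \<open>e\<close> measures the distance to the largest admissible index, so
  \<open>e = 0\<close> isolates the boundary cases.\<close>

lemma small_gens_cases:
  assumes "g \<in> small_gens n"
  obtains "g = AB"
  | k e where "g = AY (2*Suc k)" "n = k + e + 2"
  | k e where "g = XB (2*Suc k)" "n = k + e + 2"
  | k e where "g = XY (Suc k) (Suc k)" "n = k + e + 2"
  | k e where "g = XY (n + k) (n + k)" "n = k + e + 1"
proof (cases g)
  case (AY m)
  with assms have "even m" "2 \<le> m" "m \<le> 2*n - 2" by (simp_all add: mem_small_gens)
  then show ?thesis using AY that(2) by (metis even_index_cases)
next
  case (XB m)
  with assms have "even m" "2 \<le> m" "m \<le> 2*n - 2" by (simp_all add: mem_small_gens)
  then show ?thesis using XB that(3) by (metis even_index_cases)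
next
  case (XY k l)
  then have k: "l = k" "1 \<le> k" "k \<le> 2*n - 1" using assms by (simp_all add: mem_small_gens)
  show ?thesis
  proof (cases "k < n")
    case True
    then have "k = Suc (k - 1)" "n = (k - 1) + (n - k - 1) + 2" using k by presburger+
    then show ?thesis using XY k(1) that(4) by blast
  next
    case False
    then have "k = n + (k - n)" "n = (k - n) + (2*n - k - 1) + 1" using k by presburger+
    then show ?thesis using XY k(1) that(5) by blast
  qed
qed (use that(1) in blast)

lemma two_tensor [simp]: "2 * (\<phi> :: 'a \<Rightarrow> 'b \<Rightarrow> bit) = 0"
  by (simp add: mult_2)

lemma xy_self [simp]: "xy i i = bas (XY i i)"
  by (simp add: xy_def)

section \<open>The four identities of the deformation retraction\<close>

lemma proj_incl:
  assumes "g \<in> small_gens n" "2 \<le> n"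
  shows "push (link_gens n) (proj n) (incl n g) = gen_one g \<otimes> bas g"
  using assms(1)
proof (cases rule: small_gens_cases)
  \<comment> \<open>The correction term of \<open>incl\<close> lies below the diagonal, where
    \<open>proj\<close> vanishes.\<close>
  case (4 k e)
  then show ?thesis by (simp add: tensor_simps push_link push_proj_xy mem_link_gens)
next
  case (5 k e)
  \<comment> \<open>Half the index sum of \<open>xy (2*k + 1) (2*n - 1)\<close>, which is
    \<open>n + k\<close> because \<open>n = k + e + 1\<close>.\<close>
  have "(Suc (2 * k) + Suc (2 * (k + e))) div 2 = k + e + 1 + k" by simp
  then show ?thesis using 5 by (simp add: tensor_simps push_link push_proj_xy mem_link_gens add_ac)
      (simp add: mult_2)
qed (simp_all add: tensor_simps push_link mem_link_gens)

lemma incl_hom: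
  assumes "g \<in> small_gens n" "2 \<le> n"
  shows "push (link_gens n) (link_delta n) (incl n g) + push (small_gens n) (incl n) (small_delta n g) = 0"
  using assms(1)
proof (cases rule: small_gens_cases)
  case 1
  then show ?thesis using assms(2)
    by (simp add: tensor_simps push_link push_small mem_link_gens mem_small_gens)
next
  case (2 k e)
  then show ?thesis
    by (simp add: tensor_simps push_link push_small mem_link_gens mem_small_gens)
next
  \<comment> \<open>The mirror generator \<open>XY (2*k + 3) 1\<close> comes from the correction in
    \<open>incl\<close> and completes \<open>XY 1 (2*k + 3)\<close> to the \<open>xy\<close>
    required by the last arrow of \<open>small_delta\<close>. For \<open>e = 0\<close> this
    \<open>xy\<close> is the uncorrected value of \<open>incl\<close> at \<open>n\<close>.\<close>
  case (3 k e)
  then show ?thesis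
    by (cases "e = 0")
      (simp_all add: tensor_simps push_link push_small mem_link_gens mem_small_gens xy_def[of "Suc 0"])
next
  \<comment> \<open>The coefficient-free arrow out of the correction term cancels the algebra arrow
    out of \<open>xy 1 (2*k + 1)\<close>. For \<open>e = 0\<close> the correction sits at the
    maximal index \<open>2*n - 1\<close>.\<close>
  case (4 k e)
  then show ?thesis
    by (cases "e = 0")
      (simp_all add: tensor_simps push_link push_delta_xy push_small mem_link_gens mem_small_gens
        link_delta_XY small_delta_XY xy_commute[of "Suc (Suc 0)"])
next
  case (5 k e)
  then show ?thesis
    by (cases "e = 0") (simp_all add: tensor_simps push_link push_delta_xy_last push_small mem_link_gens
        mem_small_gens link_delta_XY small_delta_XY)
qed

lemma proj_hom:
  assumes "g \<in> link_gens n" "2 \<le> n"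
  shows "push (small_gens n) (small_delta n) (proj n g) + push (link_gens n) (proj n) (link_delta n g) = 0"
proof (cases g)
  case AB
  moreover have "Suc 0 \<le> 2*n - Suc 0" using assms(2) by linarith
  ultimately show ?thesis using assms(2)
    by (simp add: tensor_simps push_link push_small push_proj_xy mem_link_gens mem_small_gens)
next
  case (AY m)
  with assms(1) have "even m" "2 \<le> m" "m \<le> 2*n - 2" by (simp_all add: mem_link_gens)
  then obtain k e where "m = 2*Suc k" "n = k + e + 2" by (rule even_index_cases)
  with AY show ?thesis
    by (simp add: tensor_simps push_link push_small push_proj_xy mem_link_gens mem_small_gens)
      (simp add: mult_2 add_ac)
next
  \<comment> \<open>Here \<open>proj\<close> keeps \<open>XY 1 (m + 1)\<close>, whereas for
    \<open>AY\<close> it kills \<open>XY (m + 1) 1\<close>; this produces the asymmetry between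
    \<open>AY\<close> and \<open>XB\<close> in \<open>small_delta\<close>.\<close>
  case (XB m)
  with assms(1) have "even m" "2 \<le> m" "m \<le> 2*n - 2" by (simp_all add: mem_link_gens)
  then obtain k e where "m = 2*Suc k" "n = k + e + 2" by (rule even_index_cases)
  with XB show ?thesis
    by (simp add: tensor_simps push_link push_small push_proj_xy mem_link_gens mem_small_gens)
      (simp add: mult_2 add_ac)
next
  case (XY i j)
  note simps = tensor_simps push_link push_small push_proj_xy mem_link_gens mem_small_gens
    link_delta_XY small_delta_XY arg_cong[OF numeral_2_eq_2, of AY] arg_cong[OF numeral_2_eq_2, of XB]
  have ij: "XY i j \<in> link_gens n" using assms(1) XY by simp
  show ?thesis
  proof (cases "i \<le> j")
    case True
    from ij True show ?thesis
    proof (cases rule: XY_cases)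
      case (low d e)
      then show ?thesis unfolding XY by (cases d; cases e) (simp_all add: simps)
    next
      \<comment> \<open>Off the diagonal the coefficient-free arrow reaches column
        \<open>2*n - 2\<close>, and the correction in \<open>proj\<close> supplies the
        \<open>AY\<close> arrow of \<open>small_delta\<close>.\<close>
      case (high d e)
      then show ?thesis unfolding XY by (cases d; cases e) (simp_all add: simps)
    next
      \<comment> \<open>The correction followed by the \<open>Rho3\<close> arrow of
        \<open>AY i\<close> matches the projected algebra arrow to
        \<open>XY (i + 1) (2*n - 1)\<close>.\<close>
      case (pre d e)
      then show ?thesis unfolding XY by (cases d; cases e) (simp_all add: simps, simp_all add: mult_2 add_ac)
    next
      case (inner a d)
      moreover from this have "Suc j < 2*n - 1" by linarith
      ultimately show ?thesis unfolding XY by (cases d) (simp_all add: simps)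
    qed
  next
    \<comment> \<open>The classification is reused with indices swapped. Below the diagonal
      \<open>proj\<close> is zero; for \<open>i = 2*n - 1\<close> the arrow to
      \<open>AY (j + 1)\<close> cancels against the correction in \<open>proj\<close>.\<close>
    case False
    then have "XY j i \<in> link_gens n" "j \<le> i" using ij XY_commute_mem by auto
    then show ?thesis
    proof (cases rule: XY_cases)
      case (low d e)
      then show ?thesis using False unfolding XY by (cases d; cases e) (simp_all add: simps)
    next
      case (high d e)
      then show ?thesis using False unfolding XY by (cases d; cases e) (simp_all add: simps)
    next
      case (pre d e)
      then show ?thesis using False unfolding XY by (cases d; cases e) (simp_all add: simps)
    next
      case (inner a d)
      moreover from this have "Suc i < 2*n - 1" by linarith
      ultimately show ?thesis using False unfolding XY by (cases d) (simp_all add: simps)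
    qed
  qed
qed

text \<open>Below the diagonal \<open>homotopy\<close> undoes the coefficient-free arrow and returns
  the generator itself. Above it the same composite returns the mirror generator, which combines
  with \<open>xy i j\<close> from \<open>incl\<close> or from the differential of the preimage; the
  remaining algebra terms agree in pairs.\<close>

lemma incl_proj_homotopy:
  assumes "g \<in> link_gens n" "2 \<le> n"
  shows "push (small_gens n) (incl n) (proj n g) + gen_one g \<otimes> bas g =
    push (link_gens n) (link_delta n) (homotopy n g) + push (link_gens n) (homotopy n) (link_delta n g)"
proof (cases g)
  case AB
  moreover have "Suc 0 \<le> 2*n - Suc 0" using assms(2) by linarith
  ultimately show ?thesis using assms(2)
    by (simp add: tensor_simps push_link push_small push_homotopy_xy mem_link_gens mem_small_gens)
next
  case (AY m)
  with assms(1) have "even m" "2 \<le> m" "m \<le> 2*n - 2" by (simp_all add: mem_link_gens)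
  then obtain k e where "m = 2*Suc k" "n = k + e + 2" by (rule even_index_cases)
  with AY show ?thesis
    by (simp add: tensor_simps push_link push_small push_homotopy_xy mem_link_gens mem_small_gens)
next
  case (XB m)
  with assms(1) have "even m" "2 \<le> m" "m \<le> 2*n - 2" by (simp_all add: mem_link_gens)
  then obtain k e where "m = 2*Suc k" "n = k + e + 2" by (rule even_index_cases)
  with XB show ?thesis
    by (simp add: tensor_simps push_link push_small push_homotopy_xy mem_link_gens mem_small_gens)
next
  case (XY i j)
  note simps = tensor_simps push_link push_small push_homotopy_xy mem_link_gens mem_small_gens
    link_delta_XY
  have ij: "XY i j \<in> link_gens n" using assms(1) XY by simp
  show ?thesis
  proof (cases "i \<le> j")
    case True
    from ij True show ?thesis
    proof (cases rule: XY_cases)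
      case (low d e)
      then show ?thesis unfolding XY by (cases d; cases e) (simp_all add: simps xy_def numeral_3_eq_3)
    next
      case (high d e)
      then show ?thesis unfolding XY by (cases d; cases e) (simp_all add: simps xy_def numeral_3_eq_3)
    next
      case (pre d e)
      then show ?thesis unfolding XY by (cases d; cases e) (simp_all add: simps xy_def numeral_3_eq_3)
    next
      case (inner a d)
      moreover from this have "Suc j < 2*n - 1" by linarith
      ultimately show ?thesis unfolding XY by (cases d) (simp_all add: simps xy_def numeral_3_eq_3)
    qed
  next
    case False
    then have "XY j i \<in> link_gens n" "j \<le> i" using ij XY_commute_mem by auto
    then show ?thesis
    proof (cases rule: XY_cases)
      case (low d e)
      then show ?thesis using False unfolding XY by (cases d; cases e) (simp_all add: simps)
    next
      case (high d e)
      then show ?thesis using False unfolding XY by (cases d; cases e) (simp_all add: simps)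
    next
      case (pre d e)
      then show ?thesis using False unfolding XY by (cases d; cases e) (simp_all add: simps)
    next
      case (inner a d)
      moreover from this have "Suc i < 2*n - 1" by linarith
      ultimately show ?thesis using False unfolding XY by (cases d) (simp_all add: simps)
    qed
  qed
qed

theorem proposition5p1:
  fixes n :: nat
  assumes "n \<ge> 3"
  shows "type_DD (link_DD n) \<and> type_DD (small_DD n) \<and>
    dd_homotopy_equivalent (link_DD n) (small_DD n)"
proof (intro conjI)
  have n: "1 \<le> n" "2 \<le> n" using assms by simp_all
  show "type_DD (link_DD n)"
    unfolding link_DD_def by (intro type_DD_dd_of compat_link_delta link_delta_squared n)
  show "type_DD (small_DD n)"
    unfolding small_DD_def by (intro type_DD_dd_of compat_small_delta small_delta_squared n)
  let ?F = "lin (link_gens n) (proj n)" and ?G = "lin (small_gens n) (incl n)"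
  have "dd_hom (link_DD n) (small_DD n) ?F"
    unfolding link_DD_def small_DD_def by (intro dd_hom_lin compat_proj proj_hom n)
  moreover have "dd_hom (small_DD n) (link_DD n) ?G"
    unfolding link_DD_def small_DD_def by (intro dd_hom_lin compat_incl incl_hom n)
  moreover have "dd_homotopic (link_DD n) (link_DD n) (?G \<odot> ?F) (dd_id (link_DD n))"
    unfolding link_DD_def
    by (rule dd_homotopic_lin_id[where h = "homotopy n"])
      (simp_all add: finite_link_gens compat_homotopy incl_proj_homotopy n)
  moreover have "dd_homotopic (small_DD n) (small_DD n) (?F \<odot> ?G) (dd_id (small_DD n))"
    unfolding small_DD_def
    \<comment> \<open>By \<open>proj_incl\<close> this composite equals the identity on generators,
      so the zero homotopy works.\<close>
    by (rule dd_homotopic_lin_id[where h = "\<lambda>_. 0"])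
      (simp_all add: finite_small_gens compat_zero proj_incl push_zero push_zero_map n)
  ultimately show "dd_homotopy_equivalent (link_DD n) (small_DD n)"
    unfolding dd_homotopy_equivalent_def by blast
qed

end
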